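(* Let $H,H'\in\mathbf{K}$ be non-homeomorphic. Then (a) the sets $\mathrm{Shrp}^H$ and $\mathrm{Shrp}^{H'}$ are disjoint and Borel-inseparable, and (b) the sets $\mathrm{Blr}^H$ and $\mathrm{Blr}^{H'}$ are disjoint and Borel-inseparable; here Borel-inseparable means there is no Borel subset of $\mathbf{K}$ containing the first set and disjoint from the second.
   Context: $2^{\omega}$ is the Cantor space; $N_s=\{x\in2^\omega:s\subset x\}$; $\mu$ is the coin-tossing measure, $\mu(N_s)=2^{-\mathrm{lh}(s)}$. For measurable $A$, $\mathcal{D}_A(z)=\lim_n\mu(A\cap N_{z\restriction n})/\mu(N_{z\restriction n})$ when it exists. $\mathrm{Blur}(A)$ is the set of $z$ where $\mathcal{D}_A(z)$ does not exist; $\mathrm{Sharp}(A)$ is the set of $z$ where it exists and lies in $(0;1)$. $\mathbf{K}$ is the Polish space of compact subsets of $2^\omega$ with the Vietoris topology. For $H\in\mathbf{K}$: $\mathrm{Shrp}^H=\{K\in\mathbf{K}:\mathrm{Sharp}(K)\text{ homeomorphic to }H\}$, $\mathrm{Blr}^H=\{K\in\mathbf{K}:\mathrm{Blur}(K)\text{ homeomorphic to }H\}$. *)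

theory Defs
  imports "HOL-Analysis.Analysis" "HOL-Probability.Probability"
begin

definition cantor :: "(nat \<Rightarrow> bool) topology" where
  "cantor = product_topology (\<lambda>_. discrete_topology (UNIV :: bool set)) UNIV"

definition Nbhd :: "bool list \<Rightarrow> (nat \<Rightarrow> bool) set" where
  "Nbhd s = {x. \<forall>i < length s. x i = s ! i}"

definition restr :: "(nat \<Rightarrow> bool) \<Rightarrow> nat \<Rightarrow> bool list" where
  "restr z n = map z [0..<n]"

definition coin :: "(nat \<Rightarrow> bool) measure" where
  "coin = PiM UNIV (\<lambda>_::nat. measure_pmf (bernoulli_pmf (1/2)))"

definition mu :: "(nat \<Rightarrow> bool) set \<Rightarrow> real" where
  "mu A = measure coin A"

definition dens_ratio :: "(nat \<Rightarrow> bool) set \<Rightarrow> (nat \<Rightarrow> bool) \<Rightarrow> nat \<Rightarrow> real" where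
  "dens_ratio A z n = mu (A \<inter> Nbhd (restr z n)) / mu (Nbhd (restr z n))"

definition Blur :: "(nat \<Rightarrow> bool) set \<Rightarrow> (nat \<Rightarrow> bool) set" where
  "Blur A = {z. \<not> convergent (dens_ratio A z)}"

definition Sharp :: "(nat \<Rightarrow> bool) set \<Rightarrow> (nat \<Rightarrow> bool) set" where
  "Sharp A = {z. convergent (dens_ratio A z) \<and> lim (dens_ratio A z) \<in> {0<..<1}}"

text \<open>The hyperspace K of compact subsets of 2^omega (including the empty set).\<close>
definition Kspace :: "(nat \<Rightarrow> bool) set set" where
  "Kspace = {K. compactin cantor K}"

definition vietoris :: "(nat \<Rightarrow> bool) set topology" where
  "vietoris = topology_generated_by
     ({ {K \<in> Kspace. K \<subseteq> U} | U. openin cantor U} \<union>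
      { {K \<in> Kspace. K \<inter> U \<noteq> {}} | U. openin cantor U})"

definition borel_sets_of :: "'a topology \<Rightarrow> 'a set set" where
  "borel_sets_of T = sigma_sets (topspace T) {U. openin T U}"

definition Shrp :: "(nat \<Rightarrow> bool) set \<Rightarrow> (nat \<Rightarrow> bool) set set" where
  "Shrp H = {K \<in> Kspace. subtopology cantor (Sharp K) homeomorphic_space subtopology cantor H}"

definition Blr :: "(nat \<Rightarrow> bool) set \<Rightarrow> (nat \<Rightarrow> bool) set set" where
  "Blr H = {K \<in> Kspace. subtopology cantor (Blur K) homeomorphic_space subtopology cantor H}"

definition borel_inseparable :: "'a topology \<Rightarrow> 'a set \<Rightarrow> 'a set \<Rightarrow> bool" where
  "borel_inseparable T A B \<longleftrightarrow> \<not> (\<exists>C \<in> borel_sets_of T. A \<subseteq> C \<and> C \<inter> B = {})"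

end

theory Submission
  imports Defs
begin

text \<open>
  From dyadic weights \<open>\<alpha> w i \<in> [3/8, 5/8]\<close> that depend only on the first \<open>i\<close> bits of \<open>w\<close> one builds a
  compact set \<open>K\<close>: a point whose even bits are all true lies on the spine, and at a point leaving the
  spine \<open>K\<close> is clopen, the density of each clopen piece being chosen so that the density of \<open>K\<close> along
  a spine point \<open>z\<close> follows \<open>\<alpha> (odds z)\<close>. Hence off the spine the density is 0 or 1, while on the spine
  it diverges or is sharp according to whether \<open>\<alpha> (odds z)\<close> diverges. Given a
  \<open>G\<^sub>\<delta>\<close> set, the weights can be chosen to converge exactly on it, or exactly off it.

  Every Borel set \<open>D\<close> of Cantor space has the form \<open>{x. g x 0}\<close> for a function \<open>g\<close> with
  \<open>G\<^sub>\<delta>\<close> graph. Let \<open>K\<^sub>e\<close> be the compact set whose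
  exceptional points correspond to the pairs \<open>(u, h)\<close> such that \<open>u\<close> is in the section at \<open>e\<close> of
  the \<open>G\<^sub>\<delta>\<close> set coded by \<open>e\<close>, and \<open>h \<in> H'\<close> or \<open>h \<in> H\<close> according to the bit
  \<open>u 0\<close>. The map \<open>e \<mapsto> K\<^sub>e\<close> is continuous. If a Borel set \<open>C\<close> separated the two
  classes, a code \<open>e\<close> of the function \<open>g\<close> belonging to \<open>D = {e. K\<^sub>e \<in> C}\<close> would give a \<open>K\<^sub>e\<close> in the
  \<open>H'\<close>-class if \<open>K\<^sub>e \<in> C\<close> and in the \<open>H\<close>-class otherwise, a contradiction.
\<close>

subsection \<open>Density in Cantor space\<close>

definition agree :: "nat \<Rightarrow> (nat \<Rightarrow> bool) \<Rightarrow> (nat \<Rightarrow> bool) \<Rightarrow> bool" where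
  "agree n x y \<longleftrightarrow> (\<forall>i<n. x i = y i)"

lemma agree_refl [simp]: "agree n x x"
  by (simp add: agree_def)

lemma agree_at: "agree (Suc n) x y \<Longrightarrow> y n = x n"
  by (simp add: agree_def)

lemma agree_sym: "agree n x y \<Longrightarrow> agree n y x"
  by (simp add: agree_def)

lemma agree_trans: "agree n x y \<Longrightarrow> agree n y z \<Longrightarrow> agree n x z"
  by (simp add: agree_def)

lemma agree_mono: "agree n x y \<Longrightarrow> m \<le> n \<Longrightarrow> agree m x y"
  by (simp add: agree_def)

lemma restr_eq_iff: "restr x n = restr y n \<longleftrightarrow> agree n x y"
  by (auto simp: restr_def agree_def)

lemma length_restr [simp]: "length (restr x n) = n"
  by (simp add: restr_def)

lemma nth_restr [simp]: "i < n \<Longrightarrow> restr x n ! i = x i"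
  by (simp add: restr_def)

lemma Nbhd_restr: "Nbhd (restr x n) = {y. agree n x y}"
  unfolding Nbhd_def agree_def by (intro Collect_cong) (metis length_restr nth_restr)

lemma Nbhd_eq_emb:
  "Nbhd s = prod_emb UNIV (\<lambda>_. measure_pmf (bernoulli_pmf (1/2))) {..<length s}
     (Pi\<^sub>E {..<length s} (\<lambda>i. {s ! i}))"
  unfolding prod_emb_def Nbhd_def by (simp add: PiE_iff vimage_def Ball_def)

lemma sets_Nbhd [measurable]: "Nbhd s \<in> sets coin"
  unfolding Nbhd_eq_emb coin_def by (intro sets_PiM_I) auto

lemma prob_space_coin: "prob_space coin"
  unfolding coin_def by (intro prob_space_PiM) (rule measure_pmf.prob_space_axioms)

lemma mu_Nbhd: "mu (Nbhd s) = 1 / 2 ^ length s"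
proof -
  interpret product_prob_space "\<lambda>_::nat. measure_pmf (bernoulli_pmf (1/2))" UNIV
    by unfold_locales
  have "mu (Nbhd s) = (\<Prod>i<length s. measure (measure_pmf (bernoulli_pmf (1/2))) {s ! i})"
    unfolding mu_def coin_def Nbhd_eq_emb by (rule measure_PiM_emb) auto
  also have "\<dots> = (\<Prod>i<length s. 1 / 2)"
  proof (intro prod.cong refl)
    show "measure (measure_pmf (bernoulli_pmf (1/2))) {s ! i} = 1 / 2" for i
      by (cases "s ! i") (simp_all add: measure_pmf_single)
  qed
  finally show ?thesis by (simp add: power_divide)
qed

lemma sets_coin_local:
  assumes "\<And>x y. agree n x y \<Longrightarrow> x \<in> A \<longleftrightarrow> y \<in> A"
  shows "A \<in> sets coin"
proof -
  have "A = (\<Union>s\<in>{s. length s = n \<and> Nbhd s \<subseteq> A}. Nbhd s)"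
  proof (intro set_eqI iffI)
    fix x assume "x \<in> A"
    then have "Nbhd (restr x n) \<subseteq> A"
      using assms by (auto simp: Nbhd_restr)
    moreover have "x \<in> Nbhd (restr x n)"
      by (simp add: Nbhd_restr)
    ultimately show "x \<in> (\<Union>s\<in>{s. length s = n \<and> Nbhd s \<subseteq> A}. Nbhd s)"
      by (intro UN_I[of "restr x n"]) auto
  qed auto
  moreover have "finite {s :: bool list. length s = n \<and> Nbhd s \<subseteq> A}"
    using finite_lists_length_eq[of "UNIV :: bool set" n] by (rule rev_finite_subset) auto
  ultimately show ?thesis
    by (metis (no_types, lifting) sets.finite_UN sets_Nbhd)
qed

lemma dens_ratio_eq: "dens_ratio A z n = 2 ^ n * mu (A \<inter> {y. agree n z y})"
  unfolding dens_ratio_def mu_Nbhd length_restr unfolding Nbhd_restr by simp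

lemma dens_ratio_cong:
  assumes "\<And>y. agree n z y \<Longrightarrow> y \<in> A \<longleftrightarrow> y \<in> B"
  shows "dens_ratio A z n = dens_ratio B z n"
proof -
  have "A \<inter> {y. agree n z y} = B \<inter> {y. agree n z y}"
    using assms by blast
  then show ?thesis
    by (simp only: dens_ratio_eq)
qed

lemma dens_ratio_empty:
  assumes "\<And>y. agree n z y \<Longrightarrow> y \<notin> A"
  shows "dens_ratio A z n = 0"
proof -
  have "A \<inter> {y. agree n z y} = {}"
    using assms by blast
  then show ?thesis
    by (simp add: dens_ratio_eq mu_def)
qed

lemma dens_ratio_full:
  assumes "\<And>y. agree n z y \<Longrightarrow> y \<in> A"
  shows "dens_ratio A z n = 1"
proof -
  have "A \<inter> Nbhd (restr z n) = Nbhd (restr z n)"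
    using assms unfolding Nbhd_restr by blast
  then show ?thesis
    by (simp add: dens_ratio_def mu_Nbhd)
qed

lemma dens_ratio_nonneg: "0 \<le> dens_ratio A z n"
  by (simp add: dens_ratio_def mu_def)

lemma dens_ratio_le_1: "dens_ratio A z n \<le> 1"
proof -
  interpret prob_space coin by (rule prob_space_coin)
  have "mu (A \<inter> Nbhd (restr z n)) \<le> mu (Nbhd (restr z n))"
    unfolding mu_def by (rule finite_measure_mono) auto
  then show ?thesis
    by (simp add: dens_ratio_def mu_Nbhd field_simps)
qed

lemma dens_ratio_split:
  assumes "A \<in> sets coin"
  shows "dens_ratio A z n =
    (dens_ratio A (z(n := False)) (Suc n) + dens_ratio A (z(n := True)) (Suc n)) / 2"
proof -
  interpret prob_space coin by (rule prob_space_coin)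
  let ?N = "\<lambda>b. Nbhd (restr (z(n := b)) (Suc n))"
  have N: "Nbhd (restr z n) = ?N False \<union> ?N True" "?N False \<inter> ?N True = {}"
    by (auto simp: Nbhd_restr agree_def less_Suc_eq)
  have "mu (A \<inter> Nbhd (restr z n)) = mu ((A \<inter> ?N False) \<union> (A \<inter> ?N True))"
    unfolding N(1) by (simp add: Int_Un_distrib)
  also have "\<dots> = mu (A \<inter> ?N False) + mu (A \<inter> ?N True)"
    unfolding mu_def using assms N(2) by (intro finite_measure_Union) auto
  finally show ?thesis
    by (simp add: dens_ratio_def mu_Nbhd field_simps)
qed

text \<open>The lexicographically first \<open>k\<close> of the \<open>2 ^ m\<close> words occupying positions \<open>n, \<dots>, n + m - 1\<close>.\<close>

fun fill :: "nat \<Rightarrow> nat \<Rightarrow> nat \<Rightarrow> (nat \<Rightarrow> bool) \<Rightarrow> bool" where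
  "fill n 0 k z \<longleftrightarrow> k > 0"
| "fill n (Suc m) k z \<longleftrightarrow>
     (if z n then fill (Suc n) m (k - 2 ^ m) z else fill (Suc n) m (min k (2 ^ m)) z)"

lemma fill_local: "agree (n + m) x y \<Longrightarrow> fill n m k x = fill n m k y"
proof (induction m arbitrary: n k)
  case (Suc m)
  from Suc.prems have "x n = y n"
    by (simp add: agree_def)
  moreover have "agree (Suc n + m) x y"
    using Suc.prems by simp
  note Suc.IH[OF this]
  ultimately show ?case
    by (simp only: fill.simps)
qed simp

text \<open>Words starting with false take \<open>min k (2 ^ m)\<close> of the \<open>k\<close>
  slots, those starting with true the other \<open>k - 2 ^ m\<close>; the two shares sum to
  \<open>k\<close> even when the subtraction truncates.\<close>

lemma dens_ratio_fill: "k \<le> 2 ^ m \<Longrightarrow> dens_ratio {z. fill n m k z} z n = k / 2 ^ m"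
proof (induction m arbitrary: n k z)
  case 0
  then consider "k = 0" | "k = 1" by force
  then show ?case
    by cases (simp_all add: dens_ratio_empty dens_ratio_full)
next
  case (Suc m)
  have "{z. fill n (Suc m) k z} \<in> sets coin"
    by (rule sets_coin_local[of "n + Suc m"]) (simp only: mem_Collect_eq, rule fill_local)
  note split = dens_ratio_split[OF this, of z n]
  have "dens_ratio {z. fill n (Suc m) k z} (z(n := False)) (Suc n)
      = dens_ratio {z. fill (Suc n) m (min k (2 ^ m)) z} (z(n := False)) (Suc n)"
    by (rule dens_ratio_cong) (drule agree_at, simp)
  then have F: "dens_ratio {z. fill n (Suc m) k z} (z(n := False)) (Suc n)
      = real (min k (2 ^ m)) / 2 ^ m"
    using Suc.IH[of "min k (2 ^ m)" "Suc n" "z(n := False)"] by (simp only: min.cobounded2)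
  have "dens_ratio {z. fill n (Suc m) k z} (z(n := True)) (Suc n)
      = dens_ratio {z. fill (Suc n) m (k - 2 ^ m) z} (z(n := True)) (Suc n)"
    by (rule dens_ratio_cong) (drule agree_at, simp)
  then have T: "dens_ratio {z. fill n (Suc m) k z} (z(n := True)) (Suc n)
      = real (k - 2 ^ m) / 2 ^ m"
    using Suc.IH[of "k - 2 ^ m" "Suc n" "z(n := True)"] Suc.prems
    by (simp only: le_diff_conv power_Suc mult_2)
  have "min k (2 ^ m) + (k - 2 ^ m) = k"
    by auto
  then have "real (min k (2 ^ m)) + real (k - 2 ^ m) = real k"
    by (simp only: of_nat_add[symmetric])
  then show ?case
    unfolding split F T by (simp only: add_divide_distrib[symmetric] divide_divide_eq_left power_Suc2)
qed

subsection \<open>Compact sets with prescribed density along a spine\<close>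

definition evens :: "(nat \<Rightarrow> bool) \<Rightarrow> nat \<Rightarrow> bool" where
  "evens z = (\<lambda>i. z (2 * i))"

definition odds :: "(nat \<Rightarrow> bool) \<Rightarrow> nat \<Rightarrow> bool" where
  "odds z = (\<lambda>i. z (Suc (2 * i)))"

lemma agree_evens: "agree (2 * n) x y \<Longrightarrow> agree n (evens x) (evens y)"
  by (simp add: agree_def evens_def)

lemma agree_odds: "agree (2 * n) x y \<Longrightarrow> agree n (odds x) (odds y)"
  by (simp add: agree_def odds_def)

definition leaves :: "nat \<Rightarrow> (nat \<Rightarrow> bool) \<Rightarrow> bool" where
  "leaves i z \<longleftrightarrow> (\<forall>j<i. evens z j) \<and> \<not> evens z i"

lemma leaves_unique: "leaves i z \<Longrightarrow> leaves j z \<Longrightarrow> i = j"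
  unfolding leaves_def by (meson linorder_neqE_nat)

lemma leaves_exhaust: "(\<forall>i. evens z i) \<or> (\<exists>i. leaves i z)"
  unfolding leaves_def using exists_least_iff[of "\<lambda>i. \<not> evens z i"] by auto

lemma leaves_local: "agree (Suc (2 * i)) x y \<Longrightarrow> leaves i x = leaves i y"
  by (simp add: leaves_def agree_def evens_def)

text \<open>If the density is to be \<open>k w (i - 1) / 2 ^ (i + 2)\<close> at the \<open>i\<close>-th spine node and \<open>k w i / 2 ^ (i + 3)\<close> one
  bit further along the spine, then the piece leaving the spine must have density
  \<open>off_weight k w i / 2 ^ (i + 3)\<close>.\<close>

definition off_weight :: "((nat \<Rightarrow> bool) \<Rightarrow> nat \<Rightarrow> nat) \<Rightarrow> (nat \<Rightarrow> bool) \<Rightarrow> nat \<Rightarrow> nat" where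
  "off_weight k w i = (case i of 0 \<Rightarrow> k w 0 | Suc j \<Rightarrow> 4 * k w j - k w i)"

definition spine_set :: "((nat \<Rightarrow> bool) \<Rightarrow> nat \<Rightarrow> nat) \<Rightarrow> (nat \<Rightarrow> bool) set" where
  "spine_set k =
     {z. \<forall>i. leaves i z \<longrightarrow> fill (Suc (2 * i)) (i + 3) (off_weight k (odds z) i) z}"

definition spine_value :: "((nat \<Rightarrow> bool) \<Rightarrow> nat \<Rightarrow> nat) \<Rightarrow> (nat \<Rightarrow> bool) \<Rightarrow> nat \<Rightarrow> real" where
  "spine_value k w i = real (k w i) / 2 ^ (i + 3)"

text \<open>Values in [3/8, 5/8] leave the piece off the spine a density in [1/8, 7/8], so it can be
  realised and the subtraction in \<open>off_weight\<close> never truncates.\<close>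

locale weight =
  fixes k :: "(nat \<Rightarrow> bool) \<Rightarrow> nat \<Rightarrow> nat"
  assumes k_local: "agree i w w' \<Longrightarrow> k w i = k w' i"
    and k_lower: "3 * 2 ^ i \<le> k w i"
    and k_upper: "k w i \<le> 5 * 2 ^ i"
begin

lemma off_weight_local: "agree i w w' \<Longrightarrow> off_weight k w i = off_weight k w' i"
  unfolding off_weight_def
  using k_local[of i w w'] k_local[of "i - 1" w w'] agree_mono[of i w w' "i - 1"]
  by (cases i) simp_all

lemma off_weight_le: "off_weight k w i \<le> 2 ^ (i + 3)"
proof (cases i)
  case 0
  then show ?thesis
    using k_upper[of w 0] by (simp add: off_weight_def)
next
  case (Suc j)
  then show ?thesis
    using k_upper[of w j] k_lower[of j w] k_lower[of "Suc j" w]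
    by (simp add: off_weight_def power_add)
qed

text \<open>For \<open>i = 0\<close> the index \<open>i - 1\<close> is again 0, so the right side
  collapses to \<open>spine_value k w 0\<close>.\<close>

lemma off_weight_value:
  "real (off_weight k w i) / 2 ^ (i + 3) = 2 * spine_value k w (i - 1) - spine_value k w i"
proof (cases i)
  case 0
  then show ?thesis
    by (simp add: off_weight_def spine_value_def)
next
  case (Suc j)
  have "k w (Suc j) \<le> 4 * k w j"
    using k_upper[of w "Suc j"] k_lower[of j w] by simp
  then show ?thesis
    unfolding Suc by (simp add: off_weight_def spine_value_def power_add field_simps)
qed

lemma spine_value_local: "agree i w w' \<Longrightarrow> spine_value k w i = spine_value k w' i"
  unfolding spine_value_def by (simp only: k_local)

lemma spine_value_lower: "3 / 8 \<le> spine_value k w i"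
proof -
  have "real (3 * 2 ^ i) \<le> real (k w i)"
    using k_lower by (simp only: of_nat_le_iff)
  then show ?thesis
    by (simp add: spine_value_def power_add field_simps)
qed

lemma spine_value_upper: "spine_value k w i \<le> 5 / 8"
proof -
  have "real (k w i) \<le> real (5 * 2 ^ i)"
    using k_upper by (simp only: of_nat_le_iff)
  then show ?thesis
    by (simp add: spine_value_def power_add field_simps)
qed

lemma spine_set_cond_local:
  assumes "agree (Suc (2 * i) + (i + 3)) x y"
  shows "(leaves i x \<longrightarrow> fill (Suc (2 * i)) (i + 3) (off_weight k (odds x) i) x) \<longleftrightarrow>
         (leaves i y \<longrightarrow> fill (Suc (2 * i)) (i + 3) (off_weight k (odds y) i) y)"
proof -
  have "leaves i x = leaves i y"
    using assms by (intro leaves_local) (rule agree_mono, auto)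
  moreover have "off_weight k (odds x) i = off_weight k (odds y) i"
    using assms by (intro off_weight_local agree_odds) (rule agree_mono, auto)
  moreover note fill_local[OF assms]
  ultimately show ?thesis by metis
qed

lemma sets_spine_set: "spine_set k \<in> sets coin"
proof -
  have "spine_set k =
    (\<Inter>i. {z. leaves i z \<longrightarrow> fill (Suc (2 * i)) (i + 3) (off_weight k (odds z) i) z})"
    by (auto simp: spine_set_def)
  also have "\<dots> \<in> sets coin"
  proof (intro sets.countable_INT image_subsetI)
    fix i
    show "{z. leaves i z \<longrightarrow> fill (Suc (2 * i)) (i + 3) (off_weight k (odds z) i) z} \<in> sets coin"
      by (rule sets_coin_local, simp only: mem_Collect_eq, rule spine_set_cond_local)
  qed simp
  finally show ?thesis .
qed

text \<open>The exit level is unique, so one condition is active on this cylinder, and its weight is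
  constant there because it reads only the first \<open>i\<close> odd bits.\<close>

lemma spine_set_off:
  assumes "leaves i z" "agree (Suc (2 * i)) z y"
  shows "y \<in> spine_set k \<longleftrightarrow> fill (Suc (2 * i)) (i + 3) (off_weight k (odds z) i) y"
proof -
  have y: "leaves i y"
    using assms leaves_local by blast
  have "off_weight k (odds z) i = off_weight k (odds y) i"
    using assms(2) by (intro off_weight_local agree_odds) (rule agree_mono, auto)
  with y show ?thesis
    unfolding spine_set_def mem_Collect_eq by (metis leaves_unique)
qed

lemma dens_ratio_off:
  assumes "leaves i z"
  shows "dens_ratio (spine_set k) z (Suc (2 * i))
    = 2 * spine_value k (odds z) (i - 1) - spine_value k (odds z) i"
proof -
  have "dens_ratio (spine_set k) z (Suc (2 * i))
      = dens_ratio {y. fill (Suc (2 * i)) (i + 3) (off_weight k (odds z) i) y} z (Suc (2 * i))"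
    by (rule dens_ratio_cong) (simp only: spine_set_off[OF assms] mem_Collect_eq)
  also have "\<dots> = real (off_weight k (odds z) i) / 2 ^ (i + 3)"
    by (rule dens_ratio_fill[OF off_weight_le])
  finally show ?thesis
    by (simp only: off_weight_value)
qed

text \<open>Membership near \<open>z\<close> is decided by finitely many bits, so all longer
  cylinders around \<open>z\<close> lie inside the set or miss it.\<close>

lemma dens_ratio_off_limit:
  assumes "leaves i z"
  obtains l where "l \<in> {0, 1}" "dens_ratio (spine_set k) z \<longlonglongrightarrow> l"
proof -
  let ?m = "Suc (2 * i) + (i + 3)"
  have local: "y \<in> spine_set k \<longleftrightarrow> z \<in> spine_set k" if "agree n z y" "?m \<le> n" for n y
  proof -
    have "agree ?m z y" "agree (Suc (2 * i)) z y"
      using that by (auto intro: agree_mono)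
    then show ?thesis
      using spine_set_off[OF assms] fill_local agree_refl by metis
  qed
  define l :: real where "l = (if z \<in> spine_set k then 1 else 0)"
  have "dens_ratio (spine_set k) z n = l" if "?m \<le> n" for n
  proof (cases "z \<in> spine_set k")
    case True
    with local[OF _ that] show ?thesis
      unfolding l_def by (subst dens_ratio_full) auto
  next
    case False
    with local[OF _ that] show ?thesis
      unfolding l_def by (subst dens_ratio_empty) auto
  qed
  then have "dens_ratio (spine_set k) z \<longlonglongrightarrow> l"
    by (intro tendsto_eventually) (auto simp: eventually_sequentially)
  moreover have "l \<in> {0, 1}"
    by (simp add: l_def)
  ultimately show ?thesis
    using that by blast
qed

text \<open>The claimed densities satisfy the same averaging recursion as the true ones, and passing from
  level \<open>i\<close> to level \<open>i + 1\<close> halves the discrepancy, so it vanishes.\<close>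

lemma dens_ratio_spine_approx:
  assumes "\<forall>j<i. evens z j"
  shows "\<bar>dens_ratio (spine_set k) z (2 * i) - spine_value k (odds z) (i - 1)\<bar> \<le> (1 / 2) ^ r"
  using assms
proof (induction r arbitrary: i z)
  case 0
  have "0 \<le> dens_ratio (spine_set k) z (2 * i)" "dens_ratio (spine_set k) z (2 * i) \<le> 1"
    by (rule dens_ratio_nonneg, rule dens_ratio_le_1)
  moreover have "3 / 8 \<le> spine_value k (odds z) (i - 1)" "spine_value k (odds z) (i - 1) \<le> 5 / 8"
    by (rule spine_value_lower, rule spine_value_upper)
  ultimately show ?case
    unfolding power_0 by linarith
next
  case (Suc r)
  let ?D = "dens_ratio (spine_set k)" and ?v = "spine_value k (odds z)"
  \<comment> \<open>The node has one child off the spine, of exactly known density, and two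
    grandchildren on it, to which the induction hypothesis applies. Changing odd bit
    \<open>i\<close> does not affect \<open>?v i\<close>.\<close>
  let ?z0 = "z(2 * i := False)"
  let ?z1 = "\<lambda>b. z(2 * i := True, Suc (2 * i) := b)"
  have ag: "agree i (odds ?z0) (odds z)" "agree i (odds (?z1 b)) (odds z)" for b
    by (rule agree_odds, simp add: agree_def)+
  \<comment> \<open>As \<open>d0 = 2 * a - v\<close>, the error \<open>d - a\<close> is
    \<open>(d1 - v) / 2\<close>, half the average error of the grandchildren.\<close>
  have avg: "\<bar>d - a\<bar> \<le> 1 / 2 * e" if "d = (d0 + d1) / 2" "d1 = (x + y) / 2" "d0 = 2 * a - v"
    "\<bar>x - v\<bar> \<le> e" "\<bar>y - v\<bar> \<le> e" for d d0 d1 a v x y e :: real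
    using that by argo
  have "?D z (2 * i) = (?D ?z0 (Suc (2 * i)) + ?D (z(2 * i := True)) (Suc (2 * i))) / 2"
    by (rule dens_ratio_split[OF sets_spine_set])
  moreover have "?D (z(2 * i := True)) (Suc (2 * i))
      = (?D (?z1 False) (Suc (Suc (2 * i))) + ?D (?z1 True) (Suc (Suc (2 * i)))) / 2"
    by (rule dens_ratio_split[OF sets_spine_set])
  moreover have "?D ?z0 (Suc (2 * i)) = 2 * ?v (i - 1) - ?v i"
  proof -
    have "leaves i ?z0"
      using Suc.prems by (simp add: leaves_def evens_def)
    from dens_ratio_off[OF this] show ?thesis
      using spine_value_local[OF ag(1)] spine_value_local[OF agree_mono[OF ag(1), of "i - 1"]] by simp
  qed
  moreover have "\<bar>?D (?z1 b) (Suc (Suc (2 * i))) - ?v i\<bar> \<le> (1 / 2) ^ r" for b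
  proof -
    have "\<forall>j<Suc i. evens (?z1 b) j"
    proof (intro allI impI)
      fix j assume "j < Suc i"
      then show "evens (?z1 b) j"
        using Suc.prems unfolding evens_def
        by (cases "j = i") (auto simp: double_not_eq_Suc_double)
    qed
    from Suc.IH[OF this] show ?thesis
      unfolding mult_Suc_right diff_Suc_1 spine_value_local[OF ag(2)] by (simp only: add_2_eq_Suc)
  qed
  note this[of False] this[of True]
  ultimately show ?case
    unfolding power_Suc by (rule avg)
qed

lemma dens_ratio_spine_even:
  assumes "\<forall>j<i. evens z j"
  shows "dens_ratio (spine_set k) z (2 * i) = spine_value k (odds z) (i - 1)"
proof -
  have "\<bar>dens_ratio (spine_set k) z (2 * i) - spine_value k (odds z) (i - 1)\<bar> \<le> 0"
  proof (rule LIMSEQ_le_const)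
    show "(\<lambda>r. (1 / 2 :: real) ^ r) \<longlonglongrightarrow> 0"
      by (rule LIMSEQ_realpow_zero) auto
  qed (use dens_ratio_spine_approx[OF assms] in blast)
  then show ?thesis by simp
qed

text \<open>Lengths \<open>2 * i + 1\<close> and \<open>2 * i + 2\<close> share the value of level
  \<open>i\<close>: from the odd length both continuations stay on the spine with that same
  value.\<close>

lemma dens_ratio_spine:
  assumes "\<forall>j. evens z j"
  shows "dens_ratio (spine_set k) z (Suc n) = spine_value k (odds z) (n div 2)"
proof (cases "even n")
  case True
  then obtain i where n: "n = 2 * i" by blast
  have *: "dens_ratio (spine_set k) (z(Suc n := b)) (Suc (Suc n)) = spine_value k (odds z) i" for b
  proof -
    have "\<forall>j<Suc i. evens (z(Suc n := b)) j"
      using assms unfolding evens_def n by (metis double_not_eq_Suc_double fun_upd_other)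
    from dens_ratio_spine_even[OF this]
    have "dens_ratio (spine_set k) (z(Suc n := b)) (Suc (Suc n))
        = spine_value k (odds (z(Suc n := b))) i"
      by (simp add: n)
    also have "\<dots> = spine_value k (odds z) i"
      by (rule spine_value_local, rule agree_odds) (simp add: agree_def n)
    finally show ?thesis .
  qed
  show ?thesis
    using dens_ratio_split[OF sets_spine_set, of z "Suc n"] unfolding * by (simp add: n)
next
  case False
  then obtain i where n: "n = Suc (2 * i)"
    by (metis oddE Suc_eq_plus1)
  show ?thesis
    using dens_ratio_spine_even[of "Suc i" z] assms by (simp add: n)
qed

lemma convergent_spine_iff:
  assumes "\<forall>j. evens z j"
  shows "convergent (dens_ratio (spine_set k) z) \<longleftrightarrow> convergent (spine_value k (odds z))"
proof -
  let ?v = "spine_value k (odds z)"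
  have div2: "filterlim (\<lambda>n::nat. n div 2) sequentially sequentially"
    unfolding filterlim_at_top eventually_sequentially
  proof
    fix Z :: nat
    show "\<exists>N. \<forall>n\<ge>N. Z \<le> n div 2"
      by (rule exI[of _ "2 * Z"]) auto
  qed
  have double: "filterlim (\<lambda>n::nat. 2 * n) sequentially sequentially"
    by (rule filterlim_subseq) (auto simp: strict_mono_def)
  have "convergent (dens_ratio (spine_set k) z) \<longleftrightarrow> convergent (\<lambda>n. ?v (n div 2))"
    unfolding dens_ratio_spine[OF assms, symmetric] by (rule convergent_Suc_iff[symmetric])
  also have "\<dots> \<longleftrightarrow> convergent ?v"
    unfolding convergent_def
    using filterlim_compose[OF _ div2, of ?v] filterlim_compose[OF _ double, of "\<lambda>n. ?v (n div 2)"]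
    by auto
  finally show ?thesis .
qed

text \<open>The bounds 3/8 and 5/8 pass to the limit.\<close>

lemma lim_spine:
  assumes "\<forall>j. evens z j" "convergent (dens_ratio (spine_set k) z)"
  shows "lim (dens_ratio (spine_set k) z) \<in> {0<..<1}"
proof -
  from assms(2) have "(\<lambda>n. dens_ratio (spine_set k) z (Suc n)) \<longlonglongrightarrow> lim (dens_ratio (spine_set k) z)"
    unfolding convergent_LIMSEQ_iff by (rule LIMSEQ_Suc)
  then have lim: "(\<lambda>n. spine_value k (odds z) (n div 2)) \<longlonglongrightarrow> lim (dens_ratio (spine_set k) z)"
    by (simp only: dens_ratio_spine[OF assms(1)])
  have "3 / 8 \<le> lim (dens_ratio (spine_set k) z)"
    by (rule LIMSEQ_le_const[OF lim]) (use spine_value_lower in blast)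
  moreover have "lim (dens_ratio (spine_set k) z) \<le> 5 / 8"
    by (rule LIMSEQ_le_const2[OF lim]) (use spine_value_upper in blast)
  ultimately show ?thesis by simp
qed

lemma Blur_spine_set:
  "Blur (spine_set k) = {z. (\<forall>j. evens z j) \<and> \<not> convergent (spine_value k (odds z))}"
proof -
  have "convergent (dens_ratio (spine_set k) z)" if "leaves i z" for i z
    using dens_ratio_off_limit[OF that] convergentI by metis
  then show ?thesis
    unfolding Blur_def using leaves_exhaust convergent_spine_iff by blast
qed

lemma Sharp_spine_set:
  "Sharp (spine_set k) = {z. (\<forall>j. evens z j) \<and> convergent (spine_value k (odds z))}"
proof -
  have "lim (dens_ratio (spine_set k) z) \<notin> {0<..<1}" if "leaves i z" for i z
  proof -
    obtain l where l: "l \<in> {0, 1}" "dens_ratio (spine_set k) z \<longlonglongrightarrow> l"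
      using dens_ratio_off_limit[OF \<open>leaves i z\<close>] by blast
    show ?thesis
      using l(1) limI[OF l(2)] by auto
  qed
  then show ?thesis
    unfolding Sharp_def using leaves_exhaust convergent_spine_iff lim_spine by blast
qed

end

subsection \<open>Topology of Cantor space and its hyperspace\<close>

lemma topspace_cantor [simp]: "topspace cantor = UNIV"
  by (simp add: cantor_def PiE_UNIV_domain)

lemma compact_space_cantor: "compact_space cantor"
  by (simp add: cantor_def compact_space_product_topology compact_space_discrete_topology)

lemma Hausdorff_space_cantor: "Hausdorff_space cantor"
  by (simp add: cantor_def Hausdorff_space_product_topology)

lemma openin_cantor_iff: "openin cantor U \<longleftrightarrow> (\<forall>x\<in>U. \<exists>n. \<forall>y. agree n x y \<longrightarrow> y \<in> U)"
proof
  assume U: "openin cantor U"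
  show "\<forall>x\<in>U. \<exists>n. \<forall>y. agree n x y \<longrightarrow> y \<in> U"
  proof
    fix x assume "x \<in> U"
    then obtain V where V: "finite {i. V i \<noteq> (UNIV :: bool set)}" "x \<in> Pi\<^sub>E UNIV V" "Pi\<^sub>E UNIV V \<subseteq> U"
      using U unfolding cantor_def openin_product_topology_alt by auto
    then obtain n where n: "\<forall>i\<in>{i. V i \<noteq> UNIV}. i < n"
      unfolding finite_nat_set_iff_bounded by blast
    have "y \<in> U" if "agree n x y" for y
    proof -
      have "y i \<in> V i" for i
      proof (cases "V i = UNIV")
        case False
        then have "x i = y i"
          using n that by (simp add: agree_def)
        then show ?thesis
          using PiE_mem[OF V(2), of i] by simp
      qed simp
      then show ?thesis
        using V(3) by auto
    qed
    then show "\<exists>n. \<forall>y. agree n x y \<longrightarrow> y \<in> U"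
      by blast
  qed
next
  assume U: "\<forall>x\<in>U. \<exists>n. \<forall>y. agree n x y \<longrightarrow> y \<in> U"
  show "openin cantor U"
    unfolding cantor_def openin_product_topology_alt
  proof
    fix x assume "x \<in> U"
    with U obtain n where n: "\<forall>y. agree n x y \<longrightarrow> y \<in> U"
      by blast
    let ?V = "\<lambda>i. if i < n then {x i} else UNIV"
    have "finite {i. ?V i \<noteq> UNIV}"
      by (rule finite_subset[of _ "{..<n}"]) auto
    moreover have "y \<in> U" if "y \<in> Pi\<^sub>E UNIV ?V" for y
    proof -
      have "y i = x i" if "i < n" for i
        using PiE_mem[OF \<open>y \<in> Pi\<^sub>E UNIV ?V\<close>, of i] that by simp
      then show ?thesis
        using n by (simp add: agree_def)
    qed
    ultimately show "\<exists>V. finite {i \<in> UNIV. V i \<noteq> topspace (discrete_topology UNIV)} \<and>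
        (\<forall>i\<in>UNIV. openin (discrete_topology UNIV) (V i)) \<and> x \<in> Pi\<^sub>E UNIV V \<and> Pi\<^sub>E UNIV V \<subseteq> U"
      by (intro exI[of _ ?V]) auto
  qed
qed

lemma Kspace_iff_closedin: "K \<in> Kspace \<longleftrightarrow> closedin cantor K"
  unfolding Kspace_def mem_Collect_eq
  using compactin_imp_closedin[OF Hausdorff_space_cantor] closedin_compact_space[OF compact_space_cantor]
  by blast

lemma Kspace_iff: "K \<in> Kspace \<longleftrightarrow> (\<forall>x. (\<forall>n. \<exists>y\<in>K. agree n x y) \<longrightarrow> x \<in> K)"
  unfolding Kspace_iff_closedin closedin_def openin_cantor_iff topspace_cantor by blast

lemma Kspace_subset_open_uniform:
  assumes "K \<in> Kspace" "openin cantor U" "K \<subseteq> U"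
  obtains n where "\<And>z y. z \<in> K \<Longrightarrow> agree n z y \<Longrightarrow> y \<in> U"
proof -
  \<comment> \<open>These open sets increase with \<open>n\<close>, so a finite subcover of
    \<open>K\<close> reduces to one of them; its index acts as a Lebesgue number.\<close>
  define V where "V n = {z. \<forall>y. agree n z y \<longrightarrow> y \<in> U}" for n
  have mono: "V m \<subseteq> V n" if "m \<le> n" for m n
    using that agree_mono by (auto simp: V_def)
  have "openin cantor (V n)" for n
    unfolding openin_cantor_iff V_def using agree_trans by blast
  moreover have "K \<subseteq> \<Union> (range V)"
  proof
    fix z assume "z \<in> K"
    then obtain n where "\<forall>y. agree n z y \<longrightarrow> y \<in> U"
      using assms(2,3) unfolding openin_cantor_iff by blast
    then have "z \<in> V n"
      by (simp add: V_def)
    then show "z \<in> \<Union> (range V)"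
      by blast
  qed
  moreover have "compactin cantor K"
    using assms(1) by (simp add: Kspace_def)
  ultimately obtain \<F> where \<F>: "finite \<F>" "\<F> \<subseteq> range V" "K \<subseteq> \<Union> \<F>"
    using compactinD[of cantor K "range V"] by blast
  then obtain I where I: "finite I" "\<F> = V ` I"
    by (meson finite_subset_image subset_UNIV)
  then obtain n where "\<forall>i\<in>I. i \<le> n"
    using finite_nat_set_iff_bounded_le by blast
  with mono I \<F> have "K \<subseteq> V n"
    by blast
  then show ?thesis
    using that unfolding V_def by blast
qed

text \<open>Closeness in the Hausdorff metric at scale \<open>n\<close>.\<close>

definition approx :: "nat \<Rightarrow> (nat \<Rightarrow> bool) set \<Rightarrow> (nat \<Rightarrow> bool) set \<Rightarrow> bool" where
  "approx n K L \<longleftrightarrow> (\<forall>z\<in>K. \<exists>y\<in>L. agree n z y) \<and> (\<forall>z\<in>L. \<exists>y\<in>K. agree n z y)"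

text \<open>Subbasic sets suffice. Containment in \<open>U\<close> survives by the uniform
  \<open>n\<close> from compactness; meeting \<open>U\<close> survives because a whole cylinder
  around a common point lies in \<open>U\<close>.\<close>

lemma continuous_map_vietoris:
  assumes "\<And>e. F e \<in> Kspace"
    and F: "\<And>e n. \<exists>m. \<forall>e'. agree m e e' \<longrightarrow> approx n (F e) (F e')"
  shows "continuous_map cantor vietoris F"
  unfolding vietoris_def continuous_on_generated_topo_iff
proof (intro conjI allI impI)
  have "Kspace = {K \<in> Kspace. K \<subseteq> UNIV}" "openin cantor UNIV"
    using openin_topspace[of cantor] by auto
  then have "Kspace \<in> {{K \<in> Kspace. K \<subseteq> U} |U. openin cantor U}"
    by blast
  then show "F ` topspace cantor \<subseteq> \<Union> ({{K \<in> Kspace. K \<subseteq> U} |U. openin cantor U} \<union>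
      {{K \<in> Kspace. K \<inter> U \<noteq> {}} |U. openin cantor U})"
    using assms(1) by blast
next
  fix W
  assume "W \<in> {{K \<in> Kspace. K \<subseteq> U} |U. openin cantor U} \<union>
      {{K \<in> Kspace. K \<inter> U \<noteq> {}} |U. openin cantor U}"
  then consider U where "openin cantor U" "W = {K \<in> Kspace. K \<subseteq> U}"
    | U where "openin cantor U" "W = {K \<in> Kspace. K \<inter> U \<noteq> {}}"
    by blast
  then show "openin cantor (F -` W \<inter> topspace cantor)"
  proof cases
    case 1
    have "\<exists>m. \<forall>e'. agree m e e' \<longrightarrow> F e' \<subseteq> U" if e: "F e \<subseteq> U" for e
    proof -
      obtain n where n: "\<And>z y. z \<in> F e \<Longrightarrow> agree n z y \<Longrightarrow> y \<in> U"
        using Kspace_subset_open_uniform[OF assms(1) 1(1) e] by blast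
      obtain m where "\<forall>e'. agree m e e' \<longrightarrow> approx n (F e) (F e')"
        using F by blast
      then show ?thesis
        using n agree_sym unfolding approx_def by blast
    qed
    then show ?thesis
      using assms(1) unfolding openin_cantor_iff 1(2) by auto
  next
    case 2
    have "\<exists>m. \<forall>e'. agree m e e' \<longrightarrow> F e' \<inter> U \<noteq> {}" if e: "F e \<inter> U \<noteq> {}" for e
    proof -
      obtain z n where z: "z \<in> F e" and n: "\<forall>y. agree n z y \<longrightarrow> y \<in> U"
        using e 2(1) unfolding openin_cantor_iff by blast
      obtain m where "\<forall>e'. agree m e e' \<longrightarrow> approx n (F e) (F e')"
        using F by blast
      then show ?thesis
        using z n unfolding approx_def by blast
    qed
    then show ?thesis
      using assms(1) unfolding openin_cantor_iff 2(2) by auto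
  qed
qed

lemma borel_sets_of_vimage:
  assumes "continuous_map X Y f" "C \<in> borel_sets_of Y"
  shows "{x \<in> topspace X. f x \<in> C} \<in> borel_sets_of X"
  using assms(2) unfolding borel_sets_of_def
proof (induction rule: sigma_sets.induct)
  case (Basic U)
  then show ?case
    using assms(1) by (auto intro: openin_continuous_map_preimage)
next
  case Empty
  then show ?case
    by (simp add: sigma_sets.Empty)
next
  case (Compl A)
  have "{x \<in> topspace X. f x \<in> topspace Y - A} = topspace X - {x \<in> topspace X. f x \<in> A}"
    using continuous_map_image_subset_topspace[OF assms(1)] by auto
  then show ?case
    using sigma_sets.Compl[OF Compl.IH] by simp
next
  case (Union A)
  have "{x \<in> topspace X. f x \<in> (\<Union>i. A i)} = (\<Union>i. {x \<in> topspace X. f x \<in> A i})"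
    by auto
  then show ?case
    using sigma_sets.Union[OF Union.IH] by simp
qed

section \<open>Compactness of spine sets and their continuous dependence on the weights\<close>

context weight
begin

lemma spine_set_in_Kspace: "spine_set k \<in> Kspace"
  unfolding Kspace_iff
proof (intro allI impI)
  fix x assume x: "\<forall>n. \<exists>y\<in>spine_set k. agree n x y"
  show "x \<in> spine_set k"
    unfolding spine_set_def mem_Collect_eq
  proof
    fix i
    obtain y where "y \<in> spine_set k" "agree (Suc (2 * i) + (i + 3)) x y"
      using x by blast
    then show "leaves i x \<longrightarrow> fill (Suc (2 * i)) (i + 3) (off_weight k (odds x) i) x"
      unfolding spine_set_def mem_Collect_eq by (metis spine_set_cond_local)
  qed
qed

end

text \<open>A point leaving the spine by level \<open>n\<close> is judged by weights up to
  \<open>n\<close> only; any other point is close to the spine, which lies in every spine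
  set.\<close>

lemma spine_set_approx_aux:
  assumes k: "\<And>w i. i \<le> n \<Longrightarrow> k w i = k' w i" and z: "z \<in> spine_set k"
  shows "\<exists>y\<in>spine_set k'. agree n z y"
proof (cases "\<exists>i\<le>n. leaves i z")
  case True
  then obtain i where i: "i \<le> n" "leaves i z"
    by blast
  have "off_weight k w i = off_weight k' w i" for w
    using k[of i w] k[of "i - 1" w] i(1) by (cases i) (simp_all add: off_weight_def)
  then have "z \<in> spine_set k'"
    using z i(2) leaves_unique unfolding spine_set_def mem_Collect_eq by metis
  then show ?thesis
    using agree_refl by blast
next
  case False
  have ev: "evens z j" if "j \<le> n" for j
    using leaves_exhaust[of z]
  proof
    assume "\<exists>i. leaves i z"
    then obtain i where "leaves i z" "n < i"
      using False not_le by blast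
    then show ?thesis
      using that by (auto simp: leaves_def)
  qed blast
  \<comment> \<open>Making all even bits true moves the point onto the spine; those at levels up to
    \<open>n\<close> were true already, so the first \<open>n\<close> bits stay.\<close>
  define y where "y j = (even j \<or> z j)" for j
  have "\<not> leaves i y" for i
    by (simp add: leaves_def evens_def y_def)
  then have "y \<in> spine_set k'"
    by (simp add: spine_set_def)
  moreover have "agree n z y"
    unfolding agree_def
  proof (intro allI impI)
    fix j assume "j < n"
    then show "z j = y j"
      using ev[of "j div 2"] by (cases "even j") (auto simp: y_def evens_def)
  qed
  ultimately show ?thesis by blast
qed

lemma spine_set_approx:
  assumes "\<And>w i. i \<le> n \<Longrightarrow> k w i = k' w i"
  shows "approx n (spine_set k) (spine_set k')"
  unfolding approx_def using spine_set_approx_aux[of n k k'] spine_set_approx_aux[of n k' k] assms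
  by simp

subsection \<open>Weights converging on, or off, a given set\<close>

text \<open>The number of conditions \<open>S 0, S 1, \<dots>\<close> verified so far, counted one at a time so that the
  counter takes every value below its supremum.\<close>

fun counter :: "(nat \<Rightarrow> (nat \<Rightarrow> bool) \<Rightarrow> nat \<Rightarrow> bool) \<Rightarrow> (nat \<Rightarrow> bool) \<Rightarrow> nat \<Rightarrow> nat" where
  "counter S w 0 = 0"
| "counter S w (Suc i) = (if S (counter S w i) w i then Suc (counter S w i) else counter S w i)"

text \<open>The value is 1/2 or 5/8 by the parity of the count, so it diverges exactly when the
  count is unbounded.\<close>

definition blur_weight :: "nat \<Rightarrow> nat \<Rightarrow> nat" where
  "blur_weight i c = (if even c then 4 * 2 ^ i else 5 * 2 ^ i)"

text \<open>The value is 1/2 at odd times and \<open>1 / 2 + 1 / 2 ^ (c + 3)\<close> at even times,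
  as the count never exceeds the time; the oscillation dies out exactly when the count is
  unbounded.\<close>

definition sharp_weight :: "nat \<Rightarrow> nat \<Rightarrow> nat" where
  "sharp_weight i c = 4 * 2 ^ i + (if even i then 2 ^ (i - c) else 0)"

lemma counter_le: "counter S w i \<le> i"
  by (induction i) auto

lemma counter_mono: "i \<le> j \<Longrightarrow> counter S w i \<le> counter S w j"
  by (rule lift_Suc_mono_le[of "counter S w"]) auto

lemma counter_attains: "c \<le> counter S w i \<Longrightarrow> \<exists>j. counter S w j = c"
proof (induction i)
  case (Suc i)
  show ?case
  proof (cases "c \<le> counter S w i")
    case False
    with Suc.prems have "counter S w (Suc i) = c"
      by (simp split: if_splits)
    then show ?thesis by blast
  qed (use Suc.IH in blast)
qed (auto intro: exI[of _ 0])

text \<open>\<open>S c w n\<close> says that the first \<open>n\<close> bits of \<open>w\<close>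
  verify open condition \<open>c\<close>, so \<open>\<forall>c. \<exists>n. S c w n\<close> defines
  a G-delta set.\<close>

locale open_conditions =
  fixes S :: "nat \<Rightarrow> (nat \<Rightarrow> bool) \<Rightarrow> nat \<Rightarrow> bool"
  assumes S_local: "agree n w w' \<Longrightarrow> S c w n = S c w' n"
    and S_mono: "S c w m \<Longrightarrow> m \<le> n \<Longrightarrow> S c w n"
begin

lemma counter_local: "agree i w w' \<Longrightarrow> counter S w i = counter S w' i"
proof (induction i)
  case (Suc i)
  then have "agree i w w'"
    using agree_mono[OF Suc.prems, of i] by simp
  then show ?case
    using Suc.IH S_local by (simp only: counter.simps)
qed simp

lemma counter_unbounded:
  assumes "\<forall>c. \<exists>n. S c w n"
  shows "\<exists>i. counter S w i = c"
proof (induction c)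
  case 0
  show ?case
    by (rule exI[of _ 0]) simp
next
  case (Suc c)
  then obtain i where i: "counter S w i = c"
    by blast
  obtain n where "S c w n"
    using assms by blast
  \<comment> \<open>By time \<open>m\<close> the count has reached \<open>c\<close> and condition
    \<open>c\<close> is verified, so step \<open>m\<close> moves it beyond \<open>c\<close> unless
    it is there already.\<close>
  define m where "m = max i n"
  have S: "S c w m"
    using S_mono[OF \<open>S c w n\<close>, of m] by (simp add: m_def)
  have "Suc c \<le> counter S w (Suc m)"
  proof (cases "counter S w m = c")
    case True
    with S show ?thesis by simp
  next
    case False
    then have "Suc c \<le> counter S w m"
      using counter_mono[of i m S w] i max.cobounded1[of i n] unfolding m_def[symmetric] by linarith
    also have "\<dots> \<le> counter S w (Suc m)"
      by (rule counter_mono) simp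
    finally show ?thesis .
  qed
  then show ?case
    by (rule counter_attains)
qed

text \<open>A condition that never holds blocks the count at its index, and a bounded nondecreasing
  count is eventually constant.\<close>

lemma counter_bounded:
  assumes "\<not> (\<forall>c. \<exists>n. S c w n)"
  shows "\<exists>c n. \<forall>i\<ge>n. counter S w i = c"
proof -
  from assms obtain b where b: "\<And>n. \<not> S b w n"
    by blast
  have "counter S w i \<le> b" for i
  proof (induction i)
    case (Suc i)
    then show ?case
      using b[of i] by (cases "counter S w i = b") auto
  qed simp
  then have fin: "finite (range (counter S w))"
    by (intro finite_subset[OF _ finite_atMost[of b]]) blast
  then have "Max (range (counter S w)) \<in> range (counter S w)"
    by (intro Max_in) simp_all
  then obtain n where n: "counter S w n = Max (range (counter S w))"
    by (metis rangeE)
  have "counter S w i = counter S w n" if "n \<le> i" for i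
    using counter_mono[OF that, of S w] Max_ge[OF fin, of "counter S w i"] n by simp
  then show ?thesis by blast
qed

lemma weight_blur: "weight (\<lambda>w i. blur_weight i (counter S w i))"
proof
  show "blur_weight i (counter S w i) = blur_weight i (counter S w' i)" if "agree i w w'" for w w' i
    by (simp only: counter_local[OF that])
qed (simp_all add: blur_weight_def)

lemma weight_sharp: "weight (\<lambda>w i. sharp_weight i (counter S w i))"
proof
  show "sharp_weight i (counter S w i) \<le> 5 * 2 ^ i" for w i
    using power_increasing[of "i - counter S w i" i "2::nat"] by (simp add: sharp_weight_def)
  show "sharp_weight i (counter S w i) = sharp_weight i (counter S w' i)" if "agree i w w'" for w w' i
    by (simp only: counter_local[OF that])
qed (simp add: sharp_weight_def)

lemma spine_value_blur:
  "spine_value (\<lambda>w i. blur_weight i (counter S w i)) w i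
    = (if even (counter S w i) then 1 / 2 else 5 / 8)"
  by (simp add: spine_value_def blur_weight_def power_add)

lemma spine_value_sharp:
  "spine_value (\<lambda>w i. sharp_weight i (counter S w i)) w i
    = 1 / 2 + (if even i then (1 / 2) ^ (counter S w i + 3) else 0)"
proof -
  have "(2::real) ^ i = 2 ^ (i - counter S w i) * 2 ^ counter S w i"
    using counter_le[of S w i] by (simp flip: power_add)
  then show ?thesis
    by (simp add: spine_value_def sharp_weight_def power_add power_divide add_divide_distrib)
qed

lemma convergent_blur_iff:
  "convergent (spine_value (\<lambda>w i. blur_weight i (counter S w i)) w) \<longleftrightarrow> \<not> (\<forall>c. \<exists>n. S c w n)"
    (is "convergent ?v \<longleftrightarrow> _")
proof
  assume "convergent ?v"
  then obtain N where N: "\<And>m n. N \<le> m \<Longrightarrow> N \<le> n \<Longrightarrow> dist (?v m) (?v n) < 1 / 8"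
    using metric_CauchyD[OF convergent_Cauchy, of ?v "1 / 8"] by auto
  show "\<not> (\<forall>c. \<exists>n. S c w n)"
  proof
    assume inf: "\<forall>c. \<exists>n. S c w n"
    \<comment> \<open>Counts of different parity give values 1/8 apart. As the count never exceeds
      the time, both occur at time \<open>N\<close> or later.\<close>
    obtain i j where "counter S w i = 2 * N" "counter S w j = Suc (2 * N)"
      using counter_unbounded[OF inf, of "2 * N"] counter_unbounded[OF inf, of "Suc (2 * N)"] by blast
    moreover from this have "N \<le> i" "N \<le> j"
      using counter_le[of S w i] counter_le[of S w j] by auto
    ultimately show False
      using N[of i j] by (simp add: spine_value_blur dist_real_def)
  qed
next
  assume "\<not> (\<forall>c. \<exists>n. S c w n)"
  then obtain c n where c: "\<forall>i\<ge>n. counter S w i = c"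
    using counter_bounded by blast
  then have "eventually (\<lambda>i. ?v i = (if even c then 1 / 2 else 5 / 8)) sequentially"
    unfolding spine_value_blur eventually_sequentially by (intro exI[of _ n]) (simp add: c)
  then have "?v \<longlonglongrightarrow> (if even c then 1 / 2 else 5 / 8)"
    by (rule tendsto_eventually)
  then show "convergent ?v"
    by (rule convergentI)
qed

lemma convergent_sharp_iff:
  "convergent (spine_value (\<lambda>w i. sharp_weight i (counter S w i)) w) \<longleftrightarrow> (\<forall>c. \<exists>n. S c w n)"
    (is "convergent ?v \<longleftrightarrow> _")
proof
  assume conv: "convergent ?v"
  show "\<forall>c. \<exists>n. S c w n"
  proof (rule ccontr)
    assume "\<not> (\<forall>c. \<exists>n. S c w n)"
    then obtain c n where c: "\<forall>i\<ge>n. counter S w i = c"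
      using counter_bounded by blast
    \<comment> \<open>The tolerance is the gap between even and odd times while the count is stuck
      at \<open>c\<close>.\<close>
    obtain N where N: "\<And>m n. N \<le> m \<Longrightarrow> N \<le> n \<Longrightarrow> dist (?v m) (?v n) < (1 / 2) ^ (c + 3)"
      using metric_CauchyD[OF convergent_Cauchy[OF conv], of "(1 / 2) ^ (c + 3)"] by auto
    have "dist (?v (2 * (n + N))) (?v (Suc (2 * (n + N)))) = (1 / 2) ^ (c + 3)"
      unfolding spine_value_sharp dist_real_def using c by simp
    then show False
      using N[of "2 * (n + N)" "Suc (2 * (n + N))"] by simp
  qed
next
  assume inf: "\<forall>c. \<exists>n. S c w n"
  have "filterlim (counter S w) at_top sequentially"
    unfolding filterlim_at_top eventually_sequentially
  proof
    fix c
    obtain n where "counter S w n = c"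
      using counter_unbounded[OF inf] by blast
    then show "\<exists>n. \<forall>i\<ge>n. c \<le> counter S w i"
      using counter_mono by blast
  qed
  then have lim: "(\<lambda>i. (1 / 2 :: real) ^ counter S w i) \<longlonglongrightarrow> 0"
    by (rule filterlim_compose[OF LIMSEQ_realpow_zero, rotated 2]) auto
  have "norm (?v i - 1 / 2) \<le> (1 / 2) ^ counter S w i" for i
    by (simp add: spine_value_sharp power_add power_le_one)
  then have "eventually (\<lambda>i. norm (?v i - 1 / 2) \<le> (1 / 2) ^ counter S w i) sequentially"
    by (intro always_eventually allI)
  from Lim_null_comparison[OF this lim] have "(\<lambda>i. ?v i - 1 / 2) \<longlonglongrightarrow> 0" .
  then show "convergent ?v"
    by (rule convergentI[OF LIM_zero_cancel])
qed

lemma Blur_counter: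
  "Blur (spine_set (\<lambda>w i. blur_weight i (counter S w i)))
    = {z. (\<forall>j. evens z j) \<and> (\<forall>c. \<exists>n. S c (odds z) n)}"
  using weight.Blur_spine_set[OF weight_blur] convergent_blur_iff by simp

lemma Sharp_counter:
  "Sharp (spine_set (\<lambda>w i. sharp_weight i (counter S w i)))
    = {z. (\<forall>j. evens z j) \<and> (\<forall>c. \<exists>n. S c (odds z) n)}"
  using weight.Sharp_spine_set[OF weight_sharp] convergent_sharp_iff by simp

end

subsection \<open>Functions with \<open>G\<^sub>\<delta>\<close> graph\<close>

definition open_rel :: "((nat \<Rightarrow> bool) \<Rightarrow> (nat \<Rightarrow> bool) \<Rightarrow> bool) \<Rightarrow> bool" where
  "open_rel P \<longleftrightarrow>
     (\<forall>x u. P x u \<longrightarrow> (\<exists>n. \<forall>x' u'. agree n x x' \<longrightarrow> agree n u u' \<longrightarrow> P x' u'))"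

lemma open_rel_conj:
  assumes "open_rel P" "open_rel Q"
  shows "open_rel (\<lambda>x u. P x u \<and> Q x u)"
  unfolding open_rel_def
proof (intro allI impI)
  fix x u assume "P x u \<and> Q x u"
  then obtain m n where "\<forall>x' u'. agree m x x' \<longrightarrow> agree m u u' \<longrightarrow> P x' u'"
    "\<forall>x' u'. agree n x x' \<longrightarrow> agree n u u' \<longrightarrow> Q x' u'"
    using assms unfolding open_rel_def by meson
  then show "\<exists>n. \<forall>x' u'. agree n x x' \<longrightarrow> agree n u u' \<longrightarrow> P x' u' \<and> Q x' u'"
    by (intro exI[of _ "max m n"]) (meson agree_mono max.cobounded1 max.cobounded2)
qed

lemma open_rel_disj: "open_rel P \<Longrightarrow> open_rel Q \<Longrightarrow> open_rel (\<lambda>x u. P x u \<or> Q x u)"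
  unfolding open_rel_def by meson

lemma open_rel_ex: "(\<And>j. open_rel (P j)) \<Longrightarrow> open_rel (\<lambda>x u. \<exists>j. P j x u)"
  unfolding open_rel_def by meson

lemma open_rel_local:
  assumes "\<And>x u x' u'. agree n x x' \<Longrightarrow> agree n u u' \<Longrightarrow> P x u = P x' u'"
  shows "open_rel P"
  unfolding open_rel_def
proof (intro allI impI)
  fix x u assume "P x u"
  then show "\<exists>n. \<forall>x' u'. agree n x x' \<longrightarrow> agree n u u' \<longrightarrow> P x' u'"
    using assms by blast
qed

lemma open_rel_coordinate: "open_rel (\<lambda>x u. Q (u i))"
  by (rule open_rel_local[of "Suc i"]) (simp add: agree_def)

lemma open_rel_all_le: "(\<And>j. open_rel (P j)) \<Longrightarrow> open_rel (\<lambda>x u. \<forall>j\<le>(k::nat). P j x u)"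
proof (induction k)
  case (Suc k)
  then have "open_rel (\<lambda>x u. (\<forall>j\<le>k. P j x u) \<and> P (Suc k) x u)"
    by (intro open_rel_conj) auto
  moreover have "(\<lambda>x u. (\<forall>j\<le>k. P j x u) \<and> P (Suc k) x u) = (\<lambda>x u. \<forall>j\<le>Suc k. P j x u)"
    by (intro ext) (auto simp: le_Suc_eq)
  ultimately show ?case
    by (simp only:)
qed simp

lemma open_rel_comp:
  assumes P: "open_rel P" and f: "\<And>n. \<exists>m. \<forall>u u'. agree m u u' \<longrightarrow> agree n (f u) (f u')"
  shows "open_rel (\<lambda>x u. P x (f u))"
  unfolding open_rel_def
proof (intro allI impI)
  fix x u assume "P x (f u)"
  then obtain n where n: "\<forall>x' u'. agree n x x' \<longrightarrow> agree n (f u) u' \<longrightarrow> P x' u'"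
    using P unfolding open_rel_def by blast
  obtain m where m: "\<forall>u u'. agree m u u' \<longrightarrow> agree n (f u) (f u')"
    using f by blast
  show "\<exists>n. \<forall>x' u'. agree n x x' \<longrightarrow> agree n u u' \<longrightarrow> P x' (f u')"
  proof (intro exI allI impI)
    fix x' u' assume "agree (max m n) x x'" "agree (max m n) u u'"
    then have "agree n x x'" "agree m u u'"
      by (auto elim: agree_mono)
    then show "P x' (f u')"
      using n m by blast
  qed
qed

lemma reindex_continuous: "\<exists>m. \<forall>u u'. agree m u u' \<longrightarrow> agree n (\<lambda>i. u (p i)) (\<lambda>i. u' (p i))"
proof -
  have "finite (p ` {..<n})"
    by simp
  then obtain m where "\<forall>j\<in>p ` {..<n}. j < m"
    unfolding finite_nat_set_iff_bounded by blast
  then show ?thesis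
    unfolding agree_def by (intro exI[of _ m]) simp
qed

definition gdelta_graph :: "((nat \<Rightarrow> bool) \<Rightarrow> (nat \<Rightarrow> bool)) \<Rightarrow> bool" where
  "gdelta_graph g \<longleftrightarrow>
     (\<exists>P. (\<forall>k. open_rel (P k)) \<and> (\<forall>x u. u = g x \<longleftrightarrow> (\<forall>k::nat. P k x u)))"

lemma gdelta_graph_open:
  assumes D: "openin cantor D"
  shows "gdelta_graph (\<lambda>x i. i = 0 \<and> x \<in> D)"
proof -
  \<comment> \<open>If bit 0 is false, the closed statement \<open>x \<notin> D\<close> is split
    into open ones: no cylinder around \<open>x\<close> lies in \<open>D\<close>.\<close>
  define P where "P k x u \<longleftrightarrow> (\<forall>j\<le>k. j = 0 \<or> \<not> u j) \<and>
    (u 0 \<and> x \<in> D \<or> \<not> u 0 \<and> \<not> Nbhd (restr x k) \<subseteq> D)" for k x and u :: "nat \<Rightarrow> bool"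
  have "open_rel (\<lambda>x u. x \<in> D)"
    using D unfolding open_rel_def openin_cantor_iff by blast
  moreover have "open_rel (\<lambda>x u. \<not> Nbhd (restr x k) \<subseteq> D)" for k
    by (rule open_rel_local[of k]) (simp only: restr_eq_iff[symmetric])
  ultimately have "open_rel (P k)" for k
    unfolding P_def
    by (intro open_rel_conj open_rel_disj open_rel_all_le open_rel_coordinate)
  moreover have "u = (\<lambda>i. i = 0 \<and> x \<in> D) \<longleftrightarrow> (\<forall>k. P k x u)" for x u
  proof
    assume u: "u = (\<lambda>i. i = 0 \<and> x \<in> D)"
    have "x \<in> Nbhd (restr x k)" for k
      by (simp add: Nbhd_restr)
    then show "\<forall>k. P k x u"
      unfolding P_def u by blast
  next
    assume *: "\<forall>k. P k x u"
    have "u 0 \<longleftrightarrow> x \<in> D"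
    proof (cases "u 0")
      case True
      then show ?thesis using * unfolding P_def by blast
    next
      case False
      then have N: "\<not> Nbhd (restr x k) \<subseteq> D" for k
        using * unfolding P_def by blast
      have "x \<notin> D"
      proof
        assume "x \<in> D"
        then obtain n where "\<forall>y. agree n x y \<longrightarrow> y \<in> D"
          using D unfolding openin_cantor_iff by blast
        then show False
          using N[of n] unfolding Nbhd_restr by blast
      qed
      with False show ?thesis by simp
    qed
    moreover have "\<not> u i" if "i \<noteq> 0" for i
      using * that unfolding P_def by blast
    ultimately show "u = (\<lambda>i. i = 0 \<and> x \<in> D)"
      by (intro ext) metis
  qed
  ultimately show ?thesis
    unfolding gdelta_graph_def by (intro exI[of _ P] conjI allI)
qed

text \<open>Flipping bit 0 is a continuous involution, so the new graph is a continuous preimage of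
  the old one.\<close>

lemma gdelta_graph_compl:
  assumes "gdelta_graph g"
  shows "gdelta_graph (\<lambda>x. (g x)(0 := \<not> g x 0))"
proof -
  obtain P where P: "\<And>k. open_rel (P k)" "\<And>x u. u = g x \<longleftrightarrow> (\<forall>k::nat. P k x u)"
    using assms unfolding gdelta_graph_def by blast
  define f where "f u = u(0 := \<not> u 0)" for u :: "nat \<Rightarrow> bool"
  have "agree n (f u) (f u')" if "agree n u u'" for n u u'
    using that by (simp add: agree_def f_def)
  then have "open_rel (\<lambda>x u. P k x (f u))" for k
    by (intro open_rel_comp[OF P(1)]) blast
  moreover have "f (f u) = u" for u
    by (simp add: f_def)
  then have "u = f (g x) \<longleftrightarrow> f u = g x" for x u
    by metis
  ultimately have "gdelta_graph (\<lambda>x. f (g x))"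
    unfolding gdelta_graph_def
    by (intro exI[of _ "\<lambda>k x u. P k x (f u)"] conjI allI) (simp_all only: P(2))
  then show ?thesis
    by (simp only: f_def)
qed

text \<open>All values \<open>g j x\<close> are stored as columns of \<open>h x\<close>; what bit 0
  must satisfy then concerns the columns alone, and \<open>x\<close> enters only through the graphs
  of the \<open>g j\<close>.\<close>

lemma gdelta_graph_Union:
  fixes g :: "nat \<Rightarrow> (nat \<Rightarrow> bool) \<Rightarrow> nat \<Rightarrow> bool"
  assumes "\<And>j. gdelta_graph (g j)"
  shows "\<exists>h. gdelta_graph h \<and> (\<forall>x. h x 0 \<longleftrightarrow> (\<exists>j. g j x 0))"
proof -
  define col where "col j u = (\<lambda>i. u (Suc (prod_encode (j, i))))" for j and u :: "nat \<Rightarrow> bool"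
  define h where "h x i = (case i of 0 \<Rightarrow> (\<exists>j. g j x 0)
    | Suc p \<Rightarrow> (case prod_decode p of (j, i) \<Rightarrow> g j x i))" for x i
  obtain P where P: "\<And>j k. open_rel (P j k)" "\<And>j x u. u = g j x \<longleftrightarrow> (\<forall>k::nat. P j k x u)"
    using assms unfolding gdelta_graph_def by metis
  \<comment> \<open>Decoded, \<open>k\<close> names requirement \<open>l\<close> on column
    \<open>j\<close>; as a bound, it splits the closed statement that every column has bit 0 false
    into open ones.\<close>
  define Q where "Q k x u \<longleftrightarrow> (case prod_decode k of (j, l) \<Rightarrow> P j l x (col j u)) \<and>
    (u 0 \<and> (\<exists>j. col j u 0) \<or> \<not> u 0 \<and> (\<forall>j\<le>k. \<not> col j u 0))" for k x u
  have "open_rel (Q k)" for k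
  proof -
    obtain j l where k: "prod_decode k = (j, l)"
      by fastforce
    have "open_rel (\<lambda>x u. P j l x (col j u))"
      unfolding col_def by (rule open_rel_comp[OF P(1) reindex_continuous])
    then show ?thesis
      unfolding Q_def k prod.case
      by (intro open_rel_conj open_rel_disj open_rel_ex open_rel_all_le open_rel_coordinate)
        (simp_all add: col_def open_rel_coordinate[where Q = "\<lambda>b. b"] open_rel_coordinate)
  qed
  moreover have "u = h x \<longleftrightarrow> (\<forall>k. Q k x u)" for x u
  proof -
    have "u = h x \<longleftrightarrow> u 0 = h x 0 \<and> (\<forall>j. col j u = col j (h x))"
    proof
      assume *: "u 0 = h x 0 \<and> (\<forall>j. col j u = col j (h x))"
      show "u = h x"
      proof
        fix i
        show "u i = h x i"
        proof (cases i)
          case (Suc p)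
          obtain j l where p: "p = prod_encode (j, l)"
            by (metis prod_decode_inverse surj_pair)
          have "col j u l = col j (h x) l"
            using * by simp
          then show ?thesis
            by (simp add: col_def Suc p)
        qed (use * in simp)
      qed
    qed simp
    also have "\<dots> \<longleftrightarrow> (u 0 \<longleftrightarrow> (\<exists>j. g j x 0)) \<and> (\<forall>j. col j u = g j x)"
      by (simp add: h_def col_def)
    also have "\<dots> \<longleftrightarrow> (u 0 \<longleftrightarrow> (\<exists>j. col j u 0)) \<and> (\<forall>j. col j u = g j x)"
      by metis
    also have "\<dots> \<longleftrightarrow> (u 0 \<longleftrightarrow> (\<exists>j. col j u 0)) \<and> (\<forall>j l. P j l x (col j u))"
      by (simp only: P(2))
    also have "(\<forall>j l. P j l x (col j u)) \<longleftrightarrow>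
        (\<forall>k. case prod_decode k of (j, l) \<Rightarrow> P j l x (col j u))"
      by (metis (mono_tags, lifting) case_prod_conv prod_encode_inverse case_prodI2)
    also have "(u 0 \<longleftrightarrow> (\<exists>j. col j u 0)) \<longleftrightarrow>
        (\<forall>k. u 0 \<and> (\<exists>j. col j u 0) \<or> \<not> u 0 \<and> (\<forall>j\<le>k. \<not> col j u 0))"
      by blast
    finally show ?thesis
      unfolding Q_def all_conj_distrib by (simp only: conj_commute)
  qed
  moreover have "h x 0 \<longleftrightarrow> (\<exists>j. g j x 0)" for x
    by (simp add: h_def)
  ultimately show ?thesis
    unfolding gdelta_graph_def by (intro exI[of _ h] exI[of _ Q] conjI allI)
qed

text \<open>The graph of a characteristic function need not be G-delta. The further bits of
  \<open>g x\<close> record the values for the sets from which \<open>D\<close> is built, which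
  lowers the complexity.\<close>

lemma borel_imp_gdelta_graph:
  assumes "D \<in> borel_sets_of cantor"
  shows "\<exists>g. gdelta_graph g \<and> (\<forall>x. x \<in> D \<longleftrightarrow> g x 0)"
  using assms unfolding borel_sets_of_def
proof (induction rule: sigma_sets.induct)
  case (Basic U)
  then show ?case
    using gdelta_graph_open[of U] by (intro exI[of _ "\<lambda>x i. i = 0 \<and> x \<in> U"]) simp
next
  case Empty
  then show ?case
    using gdelta_graph_open[of "{}"] by (intro exI[of _ "\<lambda>x i. i = 0 \<and> x \<in> {}"]) simp
next
  case (Compl A)
  then obtain g where "gdelta_graph g" "\<forall>x. x \<in> A \<longleftrightarrow> g x 0"
    by blast
  then show ?case
    using gdelta_graph_compl[of g]
    by (intro exI[of _ "\<lambda>x. (g x)(0 := \<not> g x 0)"] conjI) (assumption, simp)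
next
  case (Union A)
  then obtain g where "\<And>j. gdelta_graph (g j)" "\<And>j x. x \<in> A j \<longleftrightarrow> g j x 0"
    by metis
  then obtain h where "gdelta_graph h" "\<forall>x. h x 0 \<longleftrightarrow> (\<exists>j. x \<in> A j)"
    using gdelta_graph_Union[of g] by auto
  then show ?case
    by (intro exI[of _ h]) simp
qed

subsection \<open>The diagonal argument\<close>

text \<open>A universal G-delta relation: for each \<open>k\<close> the code selects boxes of two
  cylinders of equal length, whose union is the \<open>k\<close>-th open set of pairs.\<close>

definition coded_section :: "(nat \<Rightarrow> bool) \<Rightarrow> (nat \<Rightarrow> bool) \<Rightarrow> (nat \<Rightarrow> bool) set" where
  "coded_section e x = {u. \<forall>k::nat. \<exists>m. e (to_nat (k, restr x m, restr u m))}"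

lemma gdelta_graph_coded:
  assumes "gdelta_graph g"
  shows "\<exists>e. \<forall>x. coded_section e x = {g x}"
proof -
  obtain P where P: "\<And>k. open_rel (P k)" "\<And>x u. u = g x \<longleftrightarrow> (\<forall>k::nat. P k x u)"
    using assms unfolding gdelta_graph_def by blast
  \<comment> \<open>The code selects every box contained in the \<open>k\<close>-th open
    relation.\<close>
  define e where "e n = (case from_nat n of (k, s, t) \<Rightarrow> \<forall>x'\<in>Nbhd s. \<forall>u'\<in>Nbhd t. P k x' u')" for n
  have e: "e (to_nat (k, restr x m, restr u m)) \<longleftrightarrow>
      (\<forall>x' u'. agree m x x' \<longrightarrow> agree m u u' \<longrightarrow> P k x' u')" for k x u m
    unfolding e_def from_nat_to_nat prod.case Nbhd_restr by blast
  have "(\<exists>m. e (to_nat (k, restr x m, restr u m))) \<longleftrightarrow> P k x u" for k x u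
    unfolding e using P(1)[of k] agree_refl unfolding open_rel_def by blast
  then have "u \<in> coded_section e x \<longleftrightarrow> u = g x" for x u
    unfolding coded_section_def P(2) by simp
  then have "coded_section e x = {g x}" for x
    by blast
  then show ?thesis by blast
qed

text \<open>The \<open>G\<^sub>\<delta>\<close> set of all \<open>w\<close> whose even bits form a point \<open>u\<close> of the section of the set coded by
  \<open>e\<close> at \<open>e\<close> itself and whose odd bits form a point of \<open>H (u 0)\<close>.\<close>

definition diag_cond ::
  "(bool \<Rightarrow> (nat \<Rightarrow> bool) set) \<Rightarrow> (nat \<Rightarrow> bool) \<Rightarrow> nat \<Rightarrow> (nat \<Rightarrow> bool) \<Rightarrow> nat \<Rightarrow> bool" where
  "diag_cond H e k w n \<longleftrightarrow> 2 * Suc k \<le> n \<and>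
     (\<exists>m. 2 * m \<le> n \<and> e (to_nat (k, restr e m, restr (evens w) m))) \<and>
     (\<exists>h\<in>H (w 0). agree k h (odds w))"

text \<open>The bound \<open>2 * Suc k \<le> n\<close> makes \<open>w 0\<close> and the first
  \<open>k\<close> odd bits visible among \<open>n\<close> bits, and \<open>2 * m \<le> n\<close>
  does so for the first \<open>m\<close> even bits.\<close>

lemma open_conditions_diag_cond: "open_conditions (diag_cond H e)"
proof
  fix n k and w w' :: "nat \<Rightarrow> bool"
  assume ag: "agree n w w'"
  show "diag_cond H e k w n = diag_cond H e k w' n"
  proof (cases "2 * Suc k \<le> n")
    case True
    then have "w 0 = w' 0"
      using ag by (simp add: agree_def)
    moreover have "agree k (odds w) (odds w')"
      using True by (intro agree_odds agree_mono[OF ag]) simp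
    then have "agree k h (odds w) = agree k h (odds w')" for h
      using agree_sym agree_trans by blast
    moreover have "restr (evens w) m = restr (evens w') m" if "2 * m \<le> n" for m
      unfolding restr_eq_iff using agree_evens agree_mono[OF ag that] by blast
    then have "2 * m \<le> n \<and> e (to_nat (k, restr e m, restr (evens w) m)) \<longleftrightarrow>
        2 * m \<le> n \<and> e (to_nat (k, restr e m, restr (evens w') m))" for m
      by (cases "2 * m \<le> n") simp_all
    ultimately show ?thesis
      unfolding diag_cond_def by simp
  next
    case False
    then show ?thesis by (simp add: diag_cond_def)
  qed
next
  show "diag_cond H e k w n" if "diag_cond H e k w m" "m \<le> n" for k w m n
    using that unfolding diag_cond_def by (meson order_trans)
qed

text \<open>\<open>H (w 0)\<close> is closed, so approximation at every length gives membership; the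
  length bounds are met by a large \<open>n\<close>.\<close>

lemma all_diag_cond_iff:
  assumes "\<And>b. H b \<in> Kspace"
  shows "(\<forall>k. \<exists>n. diag_cond H e k w n) \<longleftrightarrow> evens w \<in> coded_section e e \<and> odds w \<in> H (w 0)"
proof -
  have "(\<exists>n. diag_cond H e k w n) \<longleftrightarrow>
      (\<exists>m. e (to_nat (k, restr e m, restr (evens w) m))) \<and> (\<exists>h\<in>H (w 0). agree k h (odds w))"
    (is "?L \<longleftrightarrow> ?R") for k
  proof
    assume ?R
    then obtain m where "e (to_nat (k, restr e m, restr (evens w) m))"
      by blast
    then have "diag_cond H e k w (2 * Suc k + 2 * m)"
      using \<open>?R\<close> unfolding diag_cond_def by (metis le_add1 le_add2)
    then show ?L by blast
  qed (unfold diag_cond_def, blast)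
  moreover have "(\<forall>k. \<exists>h\<in>H (w 0). agree k h (odds w)) \<longleftrightarrow> odds w \<in> H (w 0)"
    using assms[of "w 0"] unfolding Kspace_iff by (meson agree_sym agree_refl)
  ultimately show ?thesis
    unfolding coded_section_def by blast
qed

lemma diag_cond_continuous:
  "\<exists>M. \<forall>e'. agree M e e' \<longrightarrow> (\<forall>k\<le>n. \<forall>i\<le>n. \<forall>w. diag_cond H e k w i = diag_cond H e' k w i)"
proof -
  let ?L = "{s::bool list. set s \<subseteq> UNIV \<and> length s \<le> n}"
  let ?T = "{..n} \<times> ?L \<times> ?L"
  have "finite (to_nat ` ?T)"
    by (intro finite_imageI finite_cartesian_product finite_lists_length_le) auto
  then obtain M where M: "\<forall>c\<in>to_nat ` ?T. c < M"
    unfolding finite_nat_set_iff_bounded by blast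
  show ?thesis
  proof (intro exI allI impI)
    fix e' k i w
    \<comment> \<open>\<open>M\<close> exceeds the finitely many codes queried up to time
      \<open>n\<close>, and \<open>n\<close> covers the words \<open>restr e m\<close>.\<close>
    assume ag: "agree (max M n) e e'" and "k \<le> n" "i \<le> n"
    have "e (to_nat (k, restr e m, restr u m)) = e' (to_nat (k, restr e' m, restr u m))"
      if "2 * m \<le> i" for m u
    proof -
      have "m \<le> n"
        using that \<open>i \<le> n\<close> by simp
      then have "restr e m = restr e' m"
        unfolding restr_eq_iff by (intro agree_mono[OF ag]) simp
      moreover have "(k, restr e m, restr u m) \<in> ?T"
        using \<open>m \<le> n\<close> \<open>k \<le> n\<close> by simp
      then have "to_nat (k, restr e m, restr u m) < max M n"
        using M by (meson image_eqI max.strict_coboundedI1)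
      then have "e (to_nat (k, restr e m, restr u m)) = e' (to_nat (k, restr e m, restr u m))"
        using ag unfolding agree_def by blast
      ultimately show ?thesis
        by simp
    qed
    then show "diag_cond H e k w i = diag_cond H e' k w i"
      unfolding diag_cond_def by blast
  qed
qed

text \<open>The count never exceeds the time, so only conditions of index at most \<open>n\<close>
  are consulted.\<close>

lemma counter_cong:
  assumes "\<And>k i. k \<le> n \<Longrightarrow> i \<le> n \<Longrightarrow> S k w i = S' k w i"
  shows "i \<le> n \<Longrightarrow> counter S w i = counter S' w i"
proof (induction i)
  case (Suc i)
  then have "counter S w i = counter S' w i"
    by simp
  moreover have "counter S' w i \<le> n"
    using counter_le[of S' w i] Suc.prems by simp
  ultimately show ?case
    using assms[of "counter S' w i" i] Suc.prems by simp
qed simp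

section \<open>Exceptional sets as homeomorphic copies, and the contradiction\<close>

lemma continuous_map_into_cantor:
  assumes "\<And>i. continuous_map X (discrete_topology UNIV) (\<lambda>x. f x i)"
  shows "continuous_map X cantor f"
  unfolding cantor_def continuous_map_componentwise_UNIV using assms by blast

lemma continuous_map_cantor_coordinate:
  "continuous_map (subtopology cantor A) (discrete_topology UNIV) (\<lambda>x. x i)"
  unfolding cantor_def
  by (intro continuous_map_from_subtopology continuous_map_product_projection) simp

lemma homeomorphic_fibre:
  "subtopology cantor {z. (\<forall>j. evens z j) \<and> evens (odds z) = u \<and> odds (odds z) \<in> H}
    homeomorphic_space subtopology cantor H"
    (is "subtopology cantor ?A homeomorphic_space _")
proof -
  define f :: "(nat \<Rightarrow> bool) \<Rightarrow> nat \<Rightarrow> bool" where "f z = odds (odds z)" for z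
  \<comment> \<open>The inverse interleaves \<open>h\<close> with the prescribed \<open>u\<close>
    and with constant true bits.\<close>
  define g :: "(nat \<Rightarrow> bool) \<Rightarrow> nat \<Rightarrow> bool" where
    "g h i = (if even i then True else if even (i div 2) then u (i div 2 div 2) else h (i div 2 div 2))" for h i
  have g: "evens (g h) j" "evens (odds (g h)) = u" "odds (odds (g h)) = h" for h j
    by (auto simp: g_def evens_def odds_def)
  have gf: "g (f z) = z" if "z \<in> ?A" for z
  proof
    fix i
    consider j where "i = 2 * j" | j where "i = Suc (2 * (2 * j))" | j where "i = Suc (2 * Suc (2 * j))"
      by (metis evenE oddE Suc_eq_plus1)
    then show "g (f z) i = z i"
    proof cases
      case 1
      then show ?thesis
        using that by (auto simp: g_def evens_def)
    next
      case 2
      have "z (Suc (2 * (2 * j))) = u j"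
        using that by (auto simp: evens_def odds_def)
      with 2 show ?thesis
        by (simp add: g_def)
    next
      case 3
      then show ?thesis
        by (simp add: g_def f_def odds_def)
    qed
  qed
  have "continuous_map (subtopology cantor ?A) cantor f"
    unfolding f_def odds_def by (intro continuous_map_into_cantor continuous_map_cantor_coordinate)
  moreover have "continuous_map (subtopology cantor H) cantor g"
  proof (rule continuous_map_into_cantor)
    show "continuous_map (subtopology cantor H) (discrete_topology UNIV) (\<lambda>h. g h i)" for i
      unfolding g_def using continuous_map_cantor_coordinate by simp
  qed
  ultimately have "homeomorphic_maps (subtopology cantor ?A) (subtopology cantor H) f g"
    unfolding homeomorphic_maps_def continuous_map_in_subtopology
    using g gf by (auto simp: f_def)
  then show ?thesis
    by (rule homeomorphic_maps_imp_homeomorphic_space)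
qed

text \<open>Parameters \<open>T\<close> and \<open>f\<close> allow one argument for
  \<open>Sharp\<close> with \<open>sharp_weight\<close> and for \<open>Blur\<close> with
  \<open>blur_weight\<close>.\<close>

lemma borel_inseparable_diag:
  assumes H: "\<And>b. H b \<in> Kspace"
    and weight: "\<And>S. open_conditions S \<Longrightarrow> weight (\<lambda>w i. f i (counter S w i))"
    and T: "\<And>S. open_conditions S \<Longrightarrow> T (spine_set (\<lambda>w i. f i (counter S w i)))
        = {z. (\<forall>j. evens z j) \<and> (\<forall>c. \<exists>n. S c (odds z) n)}"
  shows "borel_inseparable vietoris
    {K \<in> Kspace. subtopology cantor (T K) homeomorphic_space subtopology cantor (H False)}
    {K \<in> Kspace. subtopology cantor (T K) homeomorphic_space subtopology cantor (H True)}"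
  unfolding borel_inseparable_def
proof
  let ?A = "\<lambda>b. {K \<in> Kspace. subtopology cantor (T K) homeomorphic_space subtopology cantor (H b)}"
  assume "\<exists>C\<in>borel_sets_of vietoris. ?A False \<subseteq> C \<and> C \<inter> ?A True = {}"
  then obtain C where C: "C \<in> borel_sets_of vietoris" "?A False \<subseteq> C" "C \<inter> ?A True = {}"
    by blast
  define F where "F e = spine_set (\<lambda>w i. f i (counter (diag_cond H e) w i))" for e
  have F: "F e \<in> Kspace" for e
    unfolding F_def using weight[OF open_conditions_diag_cond] by (rule weight.spine_set_in_Kspace)
  have "continuous_map cantor vietoris F"
  proof (rule continuous_map_vietoris[OF F])
    fix e n
    obtain M where M: "\<forall>e'. agree M e e' \<longrightarrow>
        (\<forall>k\<le>n. \<forall>i\<le>n. \<forall>w. diag_cond H e k w i = diag_cond H e' k w i)"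
      using diag_cond_continuous by blast
    have "approx n (F e) (F e')" if "agree M e e'" for e'
    proof -
      have "counter (diag_cond H e) w i = counter (diag_cond H e') w i" if "i \<le> n" for w i
        using M \<open>agree M e e'\<close> that by (intro counter_cong[of n]) blast+
      then show ?thesis
        unfolding F_def by (intro spine_set_approx) simp
    qed
    then show "\<exists>m. \<forall>e'. agree m e e' \<longrightarrow> approx n (F e) (F e')"
      by blast
  qed
  then have "{e. F e \<in> C} \<in> borel_sets_of cantor"
    using borel_sets_of_vimage[OF _ C(1)] by fastforce
  then obtain g where g: "gdelta_graph g" "\<And>x. F x \<in> C \<longleftrightarrow> g x 0"
    using borel_imp_gdelta_graph by blast
  \<comment> \<open>The code of \<open>g\<close> is applied to itself: bit 0 of the only point of
    the section tells whether \<open>F e\<close> lies in \<open>C\<close>.\<close>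
  obtain e where e: "coded_section e e = {g e}"
    using gdelta_graph_coded[OF g(1)] by blast
  have "T (F e) = {z. (\<forall>j. evens z j) \<and> evens (odds z) = g e \<and> odds (odds z) \<in> H (odds z 0)}"
    unfolding F_def T[OF open_conditions_diag_cond] all_diag_cond_iff[of H, OF H] e by simp
  also have "\<dots> = {z. (\<forall>j. evens z j) \<and> evens (odds z) = g e \<and> odds (odds z) \<in> H (g e 0)}"
  proof -
    have "odds z 0 = g e 0" if "evens (odds z) = g e" for z
      using fun_cong[OF that, of 0] by (simp add: evens_def)
    then show ?thesis
      by (intro Collect_cong conj_cong refl) (simp only:)
  qed
  finally have "F e \<in> ?A (g e 0)"
    using homeomorphic_fibre F by simp
  \<comment> \<open>If the bit is true, \<open>F e\<close> lies in \<open>C\<close> and in the class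
    \<open>C\<close> avoids; if false, it lies outside \<open>C\<close> and in the class
    \<open>C\<close> contains.\<close>
  then show False
    using C(2,3) g(2)[of e] by (cases "g e 0") auto
qed

lemma homeomorphic_classes_disjoint:
  assumes "\<not> X homeomorphic_space Y"
  shows "{K \<in> A. t K homeomorphic_space X} \<inter> {K \<in> A. t K homeomorphic_space Y} = {}"
  using assms homeomorphic_space_sym homeomorphic_space_trans by blast

theorem theorem6p7:
  assumes "H \<in> Kspace" and "H' \<in> Kspace"
    and "\<not> (subtopology cantor H homeomorphic_space subtopology cantor H')"
  shows "Shrp H \<inter> Shrp H' = {} \<and> borel_inseparable vietoris (Shrp H) (Shrp H')
       \<and> Blr H \<inter> Blr H' = {} \<and> borel_inseparable vietoris (Blr H) (Blr H')"
proof -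
  \<comment> \<open>\<open>True\<close> selects \<open>H'\<close>, so that lying in the separating
    set forces the class which that set avoids.\<close>
  let ?H = "\<lambda>b. if b then H' else H"
  have H: "?H b \<in> Kspace" for b
    using assms by simp
  have "borel_inseparable vietoris (Shrp H) (Shrp H')"
    using borel_inseparable_diag[of ?H sharp_weight Sharp, OF H open_conditions.weight_sharp
        open_conditions.Sharp_counter]
    by (simp add: Shrp_def)
  moreover have "borel_inseparable vietoris (Blr H) (Blr H')"
    using borel_inseparable_diag[of ?H blur_weight Blur, OF H open_conditions.weight_blur
        open_conditions.Blur_counter]
    by (simp add: Blr_def)
  moreover have "Shrp H \<inter> Shrp H' = {}" "Blr H \<inter> Blr H' = {}"
    unfolding Shrp_def Blr_def by (rule homeomorphic_classes_disjoint[OF assms(3)])+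
  ultimately show ?thesis by blast
qed

end
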